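(* Let $T$ be a tree, let $c$ be a labeling of $T$, let $S=S_c(T)$ be the set of consistent vertices under $c$, and assume $|S|\ge 2$. Let $a,b\in S$ be the vertices with $c(a)=\min\{c(x):x\in S\}$ and $c(b)=\max\{c(x):x\in S\}$, and let $P_{ab}=p_1p_2\cdots p_m$ be the unique $a$--$b$ path in $T$, with $p_1=a$, $p_m=b$. Put $$L=\{z\in V(T)\setminus V(P_{ab}):c(z)<c(a)\},\qquad H=\{z\in V(T)\setminus V(P_{ab}):c(z)>c(b)\}.$$ Let $1<i<m$ and let $y$ be a neighbor of $p_i$ with $y\notin V(P_{ab})$. (i) If $i\le m-2$, then $y\in L$. (ii) If $i\ge 3$, then $y\in H$. (iii) Consequently, $\deg_T(p_i)=2$ for every $i$ with $3\le i\le m-2$.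
   Context: All graphs are finite, simple and connected; $d(u,v)$ denotes graph distance. For a graph $G$ on $n$ vertices, a labeling is a bijection $c:V(G)\to\{1,\dots,n\}$; write $c(u,v)=|c(u)-c(v)|$. A vertex $u$ is (list-distance) consistent under $c$ if for all $v,w\in V(G)$, $d(u,v)<d(u,w)$ implies $c(u,v)\le c(u,w)$. $S_c(G)$ denotes the set of consistent vertices under $c$. Part (iii) is a statement about every index $i$ in the given range (it does not presuppose the existence of $y$). *)

theory Defs
  imports "Graph_Theory.Graph_Theory"
begin

(* The locale predicate graph describes finite simple undirected graphs as symmetric digraphs:
   an undirected edge uv is the pair of arcs (u,v), (v,u), so out_degree is the usual degree
   and vpath is the usual notion of path. *)

(* The library's tree cannot be used for such graphs: there, an edge traversed back and forth is
   a cycle of length 2. Cycles of an undirected simple graph have length at least 3. *)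
definition undirected_tree :: "('v, 'e) pre_digraph \<Rightarrow> bool" where
  "undirected_tree G \<longleftrightarrow>
     graph G \<and> connected G \<and> \<not> (\<exists>p. pre_digraph.cycle G p \<and> 3 \<le> length p)"

(* Every arc has weight 1, so the cost of a walk is its length. *)
definition graph_dist :: "('v, 'e) pre_digraph \<Rightarrow> 'v \<Rightarrow> 'v \<Rightarrow> ereal" where
  "graph_dist G u v = wf_digraph.\<mu> G (\<lambda>_. 1) u v"

definition labeling :: "('v, 'e) pre_digraph \<Rightarrow> ('v \<Rightarrow> nat) \<Rightarrow> bool" where
  "labeling G c \<longleftrightarrow> bij_betw c (verts G) {1..card (verts G)}"

definition label_dist :: "('v \<Rightarrow> nat) \<Rightarrow> 'v \<Rightarrow> 'v \<Rightarrow> int" where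
  "label_dist c u v = \<bar>int (c u) - int (c v)\<bar>"

definition consistent :: "('v, 'e) pre_digraph \<Rightarrow> ('v \<Rightarrow> nat) \<Rightarrow> 'v \<Rightarrow> bool" where
  "consistent G c u \<longleftrightarrow>
     (\<forall>v\<in>verts G. \<forall>w\<in>verts G.
        graph_dist G u v < graph_dist G u w \<longrightarrow> label_dist c u v \<le> label_dist c u w)"

definition consistent_verts :: "('v, 'e) pre_digraph \<Rightarrow> ('v \<Rightarrow> nat) \<Rightarrow> 'v set" where
  "consistent_verts G c = {u \<in> verts G. consistent G c u}"

end

theory Submission
  imports Defs
begin

text \<open>
  Both endpoints of the path are consistent, so the labels of its inner vertices lie
  strictly between \<open>c a\<close> and \<open>c b\<close>. A neighbour \<open>y\<close> of \<open>p\<^sub>i\<close> off the path is one step farther than \<open>p\<^sub>i\<close> from both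
  \<open>a\<close> and \<open>b\<close>, so its label cannot lie between \<open>c a\<close> and \<open>c b\<close>. If \<open>i \<le> m - 2\<close>, comparing \<open>y\<close> with
  \<open>p\<^sub>i\<^sub>+\<^sub>2\<close> from \<open>a\<close> rules out \<open>c y > c b\<close>; if \<open>i \<ge> 3\<close>, comparing \<open>y\<close> with \<open>p\<^sub>i\<^sub>-\<^sub>2\<close> from \<open>b\<close> rules out
  \<open>c y < c a\<close>. When both apply, \<open>p\<^sub>i\<close> has no neighbour off the path.
\<close>

section \<open>Walks as vertex lists and as arc lists\<close>

text \<open>Paths are given as vertex lists, while \<open>cycle\<close> and \<open>\<mu>\<close>
  speak of arc lists; this and the converse below translate between the two.\<close>

lemma (in wf_digraph) vwalk_imp_awalk:
  assumes "vwalk p G"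
  obtains q where "awalk (hd p) q (last p)" "awalk_verts (hd p) q = p"
proof -
  have "\<exists>q. awalk (hd p) q (last p) \<and> awalk_verts (hd p) q = p"
    using assms
  proof (induct p rule: vwalk_induct)
    case (Base u)
    then show ?case by (intro exI[of _ "[]"]) (auto simp: awalk_Nil_iff)
  next
    case (Cons u v es)
    then obtain q where q: "awalk v q (last (v # es))" "awalk_verts v q = v # es" by auto
    obtain e where e: "e \<in> arcs G" "tail G e = u" "head G e = v"
      using Cons(1) by (auto simp: arcs_ends_conv)
    show ?case
      using q e by (intro exI[of _ "e # q"]) (auto simp: awalk_Cons_iff)
  qed
  then show ?thesis using that by blast
qed

lemma (in wf_digraph) awalk_imp_vwalk:
  assumes "awalk u q v"
  shows "vwalk (awalk_verts u q) G" "hd (awalk_verts u q) = u" "last (awalk_verts u q) = v"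
proof -
  show "vwalk (awalk_verts u q) G"
    using assms
  proof (induct q arbitrary: u)
    case Nil
    then show ?case by (auto simp: awalk_Nil_iff)
  next
    case (Cons e q)
    then have "vwalk (awalk_verts (head G e) q) G" "e \<in> arcs G" "tail G e = u"
      "hd (awalk_verts (head G e) q) = head G e"
      by (auto simp: awalk_Cons_iff)
    then show ?case
      by (auto intro!: vwalk_wf_digraph_consI simp: arcs_ends_conv)
  qed
  show "hd (awalk_verts u q) = u" "last (awalk_verts u q) = v"
    using assms by auto
qed

lemma vwalk_append:
  assumes "vwalk p G" "vwalk q G" "last p \<rightarrow>\<^bsub>G\<^esub> hd q"
  shows "vwalk (p @ q) G"
  using assms by (auto simp: vwalk_def vwalk_arcs_append)

lemma vwalk_rev:
  assumes "symmetric G" "vwalk p G"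
  shows "vwalk (rev p) G"
  using assms by (auto simp: vwalk_def set_vwalk_arcs_rev intro: arcs_ends_symmetric)

lemma vpath_rev:
  assumes "symmetric G" "vpath p G"
  shows "vpath (rev p) G"
  using assms by (auto simp: vpath_def intro: vwalk_rev)

lemma vpath_take:
  assumes "vpath p G" "0 < n"
  shows "vpath (take n p) G"
proof -
  have "take n p \<noteq> []" "vwalk (take n p @ drop n p) G" using assms by (auto simp: vpath_def)
  then have "vwalk (take n p) G" by (rule vwalkI_append_l)
  then show ?thesis using assms(1) by (auto simp: vpath_def)
qed

lemma vpath_drop:
  assumes "vpath p G" "n < length p"
  shows "vpath (drop n p) G"
proof -
  have "drop n p \<noteq> []" "vwalk (take n p @ drop n p) G" using assms by (auto simp: vpath_def)
  then have "vwalk (drop n p) G" by (rule vwalkI_append_r)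
  then show ?thesis using assms(1) by (auto simp: vpath_def)
qed

lemma vwalk_nth_adj:
  assumes "vwalk p G" "Suc j < length p"
  shows "p ! j \<rightarrow>\<^bsub>G\<^esub> p ! Suc j"
  using assms
proof (induct arbitrary: j rule: vwalk_induct)
  case (Base u)
  then show ?case by simp
next
  case (Cons u v es)
  then show ?case by (cases j) auto
qed

section \<open>Uniqueness of paths in a tree\<close>

text \<open>The arc from the last vertex back to the first closes the path to a cycle with as many
  arcs as \<open>q\<close> has vertices, hence at least 3.\<close>

lemma tree_vpath_not_closed:
  assumes "undirected_tree G" "vpath q G" "3 \<le> length q" "last q \<rightarrow>\<^bsub>G\<^esub> hd q"
  shows False
proof -
  interpret graph G using assms(1) by (simp add: undirected_tree_def)
  have "vwalk q G" "distinct q" using assms(2) by auto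
  obtain r where r: "awalk (hd q) r (last q)" "awalk_verts (hd q) r = q"
    using vwalk_imp_awalk[OF \<open>vwalk q G\<close>] .
  obtain e where e: "e \<in> arcs G" "tail G e = last q" "head G e = hd q"
    using assms(4) by (auto simp: arcs_ends_conv)
  have "awalk (last q) (e # r) (last q)"
    using r(1) e by (auto simp: awalk_Cons_iff)
  \<comment> \<open>A closed walk lists its base vertex at both ends; \<open>tl\<close> drops one
    copy, and \<open>cycle\<close> asks for distinctness of the rest.\<close>
  moreover have "tl (awalk_verts (last q) (e # r)) = q"
    using r e by simp
  ultimately have "cycle (e # r)"
    unfolding cycle_def using \<open>distinct q\<close> by (intro exI[of _ "last q"]) simp
  moreover have "3 \<le> length (e # r)"
    using r(2) assms(3) length_awalk_verts[of "hd q" r] by simp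
  ultimately show False using assms(1) unfolding undirected_tree_def by blast
qed

text \<open>Induction along the first path: a common second vertex reduces to the tails, and
  different second vertices would force a cycle.\<close>

lemma tree_vpath_unique:
  assumes "undirected_tree G" "vpath p G" "vpath q G" "hd p = hd q" "last p = last q"
  shows "p = q"
  using assms(2-5)
proof (induct p arbitrary: q)
  case Nil
  then show ?case by (auto simp: vpath_def vwalk_def)
next
  case (Cons u p)
  interpret graph G using assms(1) by (simp add: undirected_tree_def)
  obtain q' where q: "q = u # q'"
    using Cons.prems by (cases q) (auto simp: vpath_def vwalk_def)
  show ?case
  \<comment> \<open>If one path is just \<open>u\<close>, the other also ends in \<open>u\<close>,
    and distinctness leaves it no further vertex.\<close>
  proof (cases "p = [] \<or> q' = []")
    case True
    then show ?thesis using Cons.prems q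
      by (metis distinct.simps(2) last.simps last_in_set vpathE)
  next
    case False
    then have ne: "p \<noteq> []" "q' \<noteq> []" by auto
    have p: "vpath p G" "u \<rightarrow>\<^bsub>G\<^esub> hd p" "u \<notin> set p" "u \<in> verts G"
      using Cons.prems(1) ne by (auto simp: vpath_def elim!: vwalk_consE)
    have q': "vpath q' G" "u \<rightarrow>\<^bsub>G\<^esub> hd q'" "u \<notin> set q'"
      using Cons.prems(2) ne by (auto simp: q vpath_def elim!: vwalk_consE)
    have last: "last p = last q'" using Cons.prems(4) ne q by simp
    show ?thesis
    proof (cases "hd p = hd q'")
      case True
      then show ?thesis using Cons.hyps p q' last q by blast
    next
      case neq: False
      \<comment> \<open>The two branches leaving \<open>u\<close> meet again, so they are joined by a path avoiding \<open>u\<close>,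
        which together with \<open>u\<close> is a cycle.\<close>
      have "joinable p (rev q')" using ne last by (simp add: joinable_def hd_rev)
      moreover have "vwalk (rev q') G" "vwalk p G"
        using p q' sym_arcs by (auto intro: vwalk_rev)
      ultimately have w: "vwalk (p \<oplus> rev q') G"
        by (intro vwalk_joinI_vwalk)
      \<comment> \<open>\<open>p\<close> and \<open>q'\<close> may share more than their last
        vertex, so the joined walk is shortened to a path with the same ends.\<close>
      define r where "r = vwalk_to_vpath (p \<oplus> rev q')"
      have r: "vpath r G" unfolding r_def by (rule vwalk_to_vpath_vpath[OF w])
      have "set r \<subseteq> set (p \<oplus> rev q')"
        by (auto simp: r_def dest: vwalk_to_vpath_subset)
      also have "\<dots> \<subseteq> set p \<union> set q'"
        using set_drop_subset[of 1 "rev q'"] by (auto simp: vwalk_join_def drop_Suc)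
      finally have u: "u \<notin> set r" using p q' by blast
      have hd: "hd r = hd p"
        unfolding r_def vwalk_to_vpath_hd using ne by (simp add: vwalk_join_def)
      have la: "last r = hd q'"
        unfolding r_def vwalk_to_vpath_last using ne \<open>joinable p (rev q')\<close>
        by (simp add: vwalk_join_last last_rev)
      \<comment> \<open>The ends of \<open>r\<close> differ, so \<open>u # r\<close> has the three
        vertices that a genuine cycle needs.\<close>
      obtain x y zs where "r = x # y # zs"
        using r neq hd la by (cases r rule: vwalk_arcs.cases) (auto simp: vpath_def vwalk_def)
      moreover have "vpath (u # r) G"
        using r u p hd by (auto simp: vpath_def intro!: vwalk_consI)
      moreover have "hd q' \<rightarrow>\<^bsub>G\<^esub> u"
        using q'(2) sym_arcs by (auto intro: arcs_ends_symmetric)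
      ultimately have False
        using tree_vpath_not_closed[OF assms(1), of "u # r"] la by auto
      then show ?thesis ..
    qed
  qed
qed

section \<open>Distances in a tree, read off from paths\<close>

text \<open>Every walk with the same ends shortens to a path, which by uniqueness is
  \<open>p\<close>. So it visits all \<open>length p\<close> vertices of \<open>p\<close> and has at
  least \<open>length p - 1\<close> arcs.\<close>

lemma tree_graph_dist:
  assumes "undirected_tree G" "vpath p G"
  shows "graph_dist G (hd p) (last p) = ereal (real (length p - 1))"
proof -
  interpret graph G using assms(1) by (simp add: undirected_tree_def)
  have cost: "awalk_cost (\<lambda>_. 1) q = real (length q)" for q
    by (induct q) auto
  obtain r where r: "awalk (hd p) r (last p)" "awalk_verts (hd p) r = p"
    using vwalk_imp_awalk assms(2) by blast
  have "length r = length p - 1" using length_awalk_verts[of "hd p" r] r(2) by simp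
  then have "\<mu> (\<lambda>_. 1) (hd p) (last p) \<le> ereal (real (length p - 1))"
    using min_cost_le_walk_cost[OF r(1), of "\<lambda>_. 1"] cost by simp
  moreover have "ereal (real (length p - 1)) \<le> \<mu> (\<lambda>_. 1) (hd p) (last p)"
    unfolding \<mu>_def
  proof (rule INF_greatest)
    fix q
    assume "q \<in> {q. awalk (hd p) q (last p)}"
    then have "awalk (hd p) q (last p)" by simp
    note vw = awalk_imp_vwalk[OF this]
    let ?w = "awalk_verts (hd p) q"
    have "vwalk_to_vpath ?w = p"
      using tree_vpath_unique[OF assms(1) vwalk_to_vpath_vpath[OF vw(1)] assms(2)] vw(2,3)
      by (simp add: vwalk_to_vpath_hd vwalk_to_vpath_last)
    then have "set p \<subseteq> set ?w" using vwalk_to_vpath_subset[of _ ?w] by auto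
    then have "card (set p) \<le> card (set ?w)" by (intro card_mono) auto
    also have "\<dots> \<le> length ?w" by (rule card_length)
    finally have "length p \<le> Suc (length q)"
      using assms(2) by (simp add: vpath_def distinct_card length_awalk_verts)
    then show "ereal (real (length p - 1)) \<le> ereal (awalk_cost (\<lambda>_. 1) q)"
      by (simp add: cost)
  qed
  ultimately show ?thesis unfolding graph_dist_def by (rule antisym)
qed

lemma tree_graph_dist_nth:
  assumes "undirected_tree G" "vpath p G" "j < length p"
  shows "graph_dist G (hd p) (p ! j) = ereal (real j)"
proof -
  have "vpath (take (Suc j) p) G" using assms by (intro vpath_take) auto
  from tree_graph_dist[OF assms(1) this] show ?thesis
    using assms(3) last_snoc[of "take j p" "p ! j"]
    by (simp add: take_Suc_conv_app_nth[symmetric])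
qed

text \<open>The prefix of \<open>p\<close> ending in \<open>p ! j\<close>, extended by
  \<open>y\<close>, is again a path.\<close>

lemma tree_graph_dist_branch:
  assumes "undirected_tree G" "vpath p G" "j < length p" "p ! j \<rightarrow>\<^bsub>G\<^esub> y" "y \<notin> set p"
  shows "graph_dist G (hd p) y = ereal (real (Suc j))"
proof -
  interpret graph G using assms(1) by (simp add: undirected_tree_def)
  have "vpath (take (Suc j) p) G" using assms by (intro vpath_take) auto
  moreover have "last (take (Suc j) p) = p ! j"
    by (simp add: take_Suc_conv_app_nth[OF assms(3)])
  moreover have "vwalk [y] G" using assms(4) by (intro vwalkI) auto
  ultimately have "vpath (take (Suc j) p @ [y]) G"
    using assms(4,5) by (auto simp: vpath_def intro!: vwalk_append dest: in_set_takeD)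
  moreover have "hd (take (Suc j) p @ [y]) = hd p" using assms(3) by (cases p) auto
  ultimately show ?thesis
    using tree_graph_dist[OF assms(1), of "take (Suc j) p @ [y]"] assms(3) by simp
qed

section \<open>Neighbours of an inner path vertex\<close>

text \<open>A chord would close the segment of \<open>p\<close> between its ends to a cycle.\<close>

lemma tree_vpath_chordless:
  assumes "undirected_tree G" "vpath p G" "j < k" "k < length p" "p ! j \<rightarrow>\<^bsub>G\<^esub> p ! k"
  shows "k = Suc j"
proof (rule ccontr)
  assume "k \<noteq> Suc j"
  interpret graph G using assms(1) by (simp add: undirected_tree_def)
  let ?q = "drop j (take (Suc k) p)"
  have "vpath ?q G" using assms by (intro vpath_drop vpath_take) auto
  moreover have "3 \<le> length ?q" using assms \<open>k \<noteq> Suc j\<close> by auto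
  moreover have "hd ?q = p ! j" using assms by (simp add: hd_drop_conv_nth)
  moreover have "last ?q = p ! k"
    using assms by (simp add: take_Suc_conv_app_nth)
  moreover have "p ! k \<rightarrow>\<^bsub>G\<^esub> p ! j" using assms(5) sym_arcs by (auto intro: arcs_ends_symmetric)
  ultimately show False using tree_vpath_not_closed[OF assms(1)] by metis
qed

text \<open>Without parallel arcs, an arc leaving \<open>u\<close> is determined by its
  head.\<close>

lemma (in nomulti_digraph) out_degree_eq_card_neighbours:
  "out_degree G u = card {v. u \<rightarrow>\<^bsub>G\<^esub> v}"
proof -
  have "inj_on (head G) (out_arcs G u)"
    by (auto intro!: inj_onI no_multi_arcs simp: arc_to_ends_def)
  moreover have "head G ` out_arcs G u = {v. u \<rightarrow>\<^bsub>G\<^esub> v}"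
    by (auto simp: arcs_ends_conv)
  ultimately show ?thesis unfolding out_degree_def by (metis card_image)
qed

lemma tree_neighbours_on_vpath:
  assumes "undirected_tree G" "vpath p G" "0 < j" "Suc j < length p"
  shows "{v \<in> set p. p ! j \<rightarrow>\<^bsub>G\<^esub> v} = {p ! (j - 1), p ! Suc j}"
proof (intro equalityI subsetI)
  interpret graph G using assms(1) by (simp add: undirected_tree_def)
  fix v
  {
    assume "v \<in> {v \<in> set p. p ! j \<rightarrow>\<^bsub>G\<^esub> v}"
    then obtain k where k: "k < length p" "v = p ! k" "p ! j \<rightarrow>\<^bsub>G\<^esub> p ! k"
      by (auto simp: in_set_conv_nth)
    have "p ! k \<rightarrow>\<^bsub>G\<^esub> p ! j" using k(3) sym_arcs by (auto intro: arcs_ends_symmetric)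
    consider "j < k" | "j = k" | "k < j" by linarith
    then show "v \<in> {p ! (j - 1), p ! Suc j}"
    proof cases
      case 1
      then show ?thesis using tree_vpath_chordless[OF assms(1,2)] k by blast
    next
      case 2
      then show ?thesis using k(3) adj_not_same by blast
    next
      case 3
      then have "j = Suc k"
        using tree_vpath_chordless[OF assms(1,2)] assms(4) \<open>p ! k \<rightarrow>\<^bsub>G\<^esub> p ! j\<close> by simp
      then show ?thesis using k by simp
    qed
  next
    assume v: "v \<in> {p ! (j - 1), p ! Suc j}"
    have "p ! (j - 1) \<rightarrow>\<^bsub>G\<^esub> p ! j" "p ! j \<rightarrow>\<^bsub>G\<^esub> p ! Suc j"
      using vwalk_nth_adj[of p G "j - 1"] vwalk_nth_adj[of p G j] assms by auto
    moreover from this have "p ! j \<rightarrow>\<^bsub>G\<^esub> p ! (j - 1)"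
      using sym_arcs by (auto intro: arcs_ends_symmetric)
    ultimately show "v \<in> {v \<in> set p. p ! j \<rightarrow>\<^bsub>G\<^esub> v}" using v assms by auto
  }
qed

theorem corollary3p6:
  fixes T :: "('v, 'e) pre_digraph"
    and c :: "'v \<Rightarrow> nat"
    and S L H :: "'v set"
    and a b :: 'v
    and p :: "'v list"
    and m :: nat
  assumes "undirected_tree T"
    and "labeling T c"
    and "S = consistent_verts T c"
    and "card S \<ge> 2"
    and "a \<in> S" and "c a = Min (c ` S)"
    and "b \<in> S" and "c b = Max (c ` S)"
    and "vpath p T" and "hd p = a" and "last p = b" and "length p = m"
    and "L = {z \<in> verts T - set p. c z < c a}"
    and "H = {z \<in> verts T - set p. c z > c b}"
  shows
    "(\<forall>i y. 1 < i \<and> i < m \<and> p ! (i - 1) \<rightarrow>\<^bsub>T\<^esub> y \<and> y \<notin> set p \<longrightarrow>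
        (i + 2 \<le> m \<longrightarrow> y \<in> L) \<and> (3 \<le> i \<longrightarrow> y \<in> H)) \<and>
     (\<forall>i. 3 \<le> i \<and> i + 2 \<le> m \<longrightarrow> out_degree T (p ! (i - 1)) = 2)"
proof -
  interpret graph T using assms(1) by (simp add: undirected_tree_def)
  note tree = assms(1) and path = \<open>vpath p T\<close>
  have fin: "finite S" using assms(3) by (simp add: consistent_verts_def)
  have cab: "c a \<le> c b" using assms(5-8) fin by (metis Max_ge finite_imageI imageI)
  have inj: "c u = c v \<longleftrightarrow> u = v" if "u \<in> verts T" "v \<in> verts T" for u v
    using assms(2) that by (auto simp: labeling_def bij_betw_def inj_on_def)
  have cons: "label_dist c u v \<le> label_dist c u w"
    if "graph_dist T u v < graph_dist T u w" "u \<in> S" "v \<in> verts T" "w \<in> verts T" for u v w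
    using that assms(3) by (auto simp: consistent_verts_def consistent_def)
  have "p \<noteq> []" "distinct p" and pv: "set p \<subseteq> verts T"
    using path by (auto simp: vpath_def vwalk_def)
  have len: "length p = m" by fact
  have nthv: "p ! j \<in> verts T" if "j < m" for j using that pv len by auto
  have b_last: "b = p ! (m - 1)" using \<open>p \<noteq> []\<close> \<open>last p = b\<close> len by (auto simp: last_conv_nth)
  have a_hd: "a = p ! 0" using \<open>p \<noteq> []\<close> \<open>hd p = a\<close> by (auto simp: hd_conv_nth)
  \<comment> \<open>Distances from \<open>b\<close> are read off the reversed path, where
    \<open>p ! j\<close> has index \<open>m - 1 - j\<close>.\<close>
  have path': "vpath (rev p) T" using path sym_arcs by (intro vpath_rev)
  have hd': "hd (rev p) = b" using \<open>last p = b\<close> by (simp add: hd_rev)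
  have da: "graph_dist T a (p ! j) = ereal (real j)" if "j < m" for j
    using tree_graph_dist_nth[OF tree path] that len \<open>hd p = a\<close> by auto
  have db: "graph_dist T b (p ! j) = ereal (real (m - 1 - j))" if "j < m" for j
    using tree_graph_dist_nth[OF tree path', of "m - 1 - j"] that len hd' by (auto simp: rev_nth)
  have inner: "c a < c (p ! j)" "c (p ! j) < c b" if "0 < j" "j < m - 1" for j
  proof -
    have "p ! j \<noteq> a" "p ! j \<noteq> b"
      using that \<open>distinct p\<close> len unfolding a_hd b_last by (simp_all add: nth_eq_iff_index_eq)
    then have "c (p ! j) \<noteq> c a" "c (p ! j) \<noteq> c b"
      using inj nthv that a_hd b_last by auto
    \<comment> \<open>An inner vertex is nearer to each end than the other end is, so its label is
      within \<open>c b - c a\<close> of both \<open>c a\<close> and \<open>c b\<close>.\<close>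
    moreover have "label_dist c a (p ! j) \<le> label_dist c a b"
      using that da[of j] da[of "m - 1"] assms(5) nthv
      unfolding b_last by (intro cons) auto
    moreover have "label_dist c b (p ! j) \<le> label_dist c b a"
      using that db[of j] db[of 0] assms(7) nthv
      unfolding a_hd by (intro cons) auto
    ultimately show "c a < c (p ! j)" "c (p ! j) < c b"
      using cab unfolding label_dist_def by linarith+
  qed
  \<comment> \<open>The weak form includes the ends, since \<open>p ! (j + 2)\<close> or
    \<open>p ! (j - 2)\<close> below may be one of them.\<close>
  have bounds: "c a \<le> c (p ! j) \<and> c (p ! j) \<le> c b" if "j < m" for j
  proof -
    consider "j = 0" | "j = m - 1" | "0 < j" "j < m - 1" using \<open>j < m\<close> by linarith
    then show ?thesis using cab inner[of j] a_hd b_last by cases auto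
  qed
  \<comment> \<open>Indices count from 0 here: \<open>j = i - 1\<close> turns
    \<open>i + 2 \<le> m\<close> into \<open>j + 2 < m\<close> and \<open>3 \<le> i\<close> into
    \<open>2 \<le> j\<close>.\<close>
  have branch: "(j + 2 < m \<longrightarrow> y \<in> L) \<and> (2 \<le> j \<longrightarrow> y \<in> H)"
    if j: "0 < j" "j < m - 1" and y: "p ! j \<rightarrow>\<^bsub>T\<^esub> y" "y \<notin> set p" for j y
  proof -
    have yv: "y \<in> verts T" using y by auto
    have "p ! j \<in> set p" using j len by auto
    then have "c y \<noteq> c (p ! j)" using inj[OF yv] y nthv j by auto
    have day: "graph_dist T a y = ereal (real (Suc j))"
      using tree_graph_dist_branch[OF tree path _ y(1)] y(2) j len \<open>hd p = a\<close> by auto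
    have "rev p ! (m - 1 - j) = p ! j" using j len by (simp add: rev_nth)
    then have dby: "graph_dist T b y = ereal (real (m - j))"
      using tree_graph_dist_branch[OF tree path', of "m - 1 - j" y] y j len hd' by auto
    have 1: "label_dist c a (p ! j) \<le> label_dist c a y"
      using da[of j] day assms(5) nthv yv j by (intro cons) auto
    have 2: "label_dist c b (p ! j) \<le> label_dist c b y"
      using db[of j] dby assms(7) nthv yv j by (intro cons) auto
    \<comment> \<open>A label between \<open>c a\<close> and \<open>c b\<close> would be at least
      \<open>c (p ! j)\<close> by 1 and at most \<open>c (p ! j)\<close> by 2, but equality is
      excluded.\<close>
    have 3: "c y < c a \<or> c y > c b"
      using 1 2 inner[OF j] \<open>c y \<noteq> c (p ! j)\<close> unfolding label_dist_def by linarith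
    have "y \<in> L" if "j + 2 < m"
    proof -
      \<comment> \<open>From \<open>a\<close>, \<open>y\<close> is at distance \<open>j + 1\<close>,
        just below that of \<open>p ! (j + 2)\<close>, whose label is at most
        \<open>c b\<close>.\<close>
      have "label_dist c a y \<le> label_dist c a (p ! (j + 2))"
        using da[of "j + 2"] day assms(5) nthv yv that by (intro cons) auto
      then have "\<not> c y > c b"
        using bounds[OF that] cab unfolding label_dist_def by linarith
      then show ?thesis using 3 yv y(2) by (simp add: \<open>L = _\<close>)
    qed
    moreover have "y \<in> H" if "2 \<le> j"
    proof -
      \<comment> \<open>Mirror image: from \<open>b\<close> the distances are \<open>m - j\<close>
        and \<open>m - j + 1\<close>.\<close>
      have "label_dist c b y \<le> label_dist c b (p ! (j - 2))"
        using db[of "j - 2"] dby assms(7) nthv yv that j by (intro cons) auto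
      then have "\<not> c y < c a"
        using bounds[of "j - 2"] cab j unfolding label_dist_def by linarith
      then show ?thesis using 3 yv y(2) by (simp add: \<open>H = _\<close>)
    qed
    ultimately show ?thesis by blast
  qed
  have deg: "out_degree T (p ! j) = 2" if j: "2 \<le> j" "j + 2 < m" for j
  proof -
    have "v \<in> set p" if "p ! j \<rightarrow>\<^bsub>T\<^esub> v" for v
    proof (rule ccontr)
      assume "v \<notin> set p"
      then have "v \<in> L" "v \<in> H" using branch[of j v] that j by auto
      then show False using cab by (simp add: \<open>L = _\<close> \<open>H = _\<close>)
    qed
    then have "{v. p ! j \<rightarrow>\<^bsub>T\<^esub> v} = {v \<in> set p. p ! j \<rightarrow>\<^bsub>T\<^esub> v}" by blast
    also have "\<dots> = {p ! (j - 1), p ! Suc j}"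
      using tree_neighbours_on_vpath[OF tree path] j len by simp
    finally show ?thesis
      using \<open>distinct p\<close> j len by (simp add: out_degree_eq_card_neighbours nth_eq_iff_index_eq)
  qed
  show ?thesis
  proof (intro conjI allI impI; (elim conjE)?)
    fix i y
    assume "1 < i" "i < m" "p ! (i - 1) \<rightarrow>\<^bsub>T\<^esub> y" "y \<notin> set p"
    note br = branch[of "i - 1" y, OF _ _ this(3,4)]
    show "y \<in> L" if "i + 2 \<le> m" using br that \<open>1 < i\<close> by simp
    show "y \<in> H" if "3 \<le> i" using br that \<open>i < m\<close> by simp
  next
    fix i
    assume "3 \<le> i" "i + 2 \<le> m"
    then show "out_degree T (p ! (i - 1)) = 2" by (intro deg) auto
  qed
qed

end
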